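(* Let $(Y,d)$ be a metric space with a fixed base point $y_0\in Y$, let $0<\beta\le 1$, and let $\mathbb{R}^n\times Y$ be equipped with the metric $$d((x_1,y_1),(x_2,y_2))=\max\{|x_1-x_2|^\beta,\ d(y_1,y_2)\},\qquad (x_1,y_1),(x_2,y_2)\in\mathbb{R}^n\times Y.$$ Let $E$ be the set of Lipschitz maps $h:(Y,d)\to(\mathbb{R}^n,|\cdot|^\beta)$ with $h(y_0)=0$. Suppose that a locally compact group $\Gamma$ acts continuously on $\mathbb{R}^n\times Y$ by biLipschitz maps, and that for every $\gamma\in\Gamma$ there exist $a_\gamma\in\mathbb{R}_+$, $A_\gamma\in O(n)$, $x_\gamma\in\mathbb{R}^n$, $h_\gamma\in E$ and a similarity $\sigma_\gamma:Y\to Y$ such that $$\gamma(x,y)=\big(a_\gamma A_\gamma(x+x_\gamma+h_\gamma(y)),\ \sigma_\gamma(y)\big)\qquad\text{for all }(x,y)\in\mathbb{R}^n\times Y.$$ If $\Gamma$ is amenable and is a uniform quasisimilarity group of $\mathbb{R}^n\times Y$, then there exists some $h_0\in E$ such that, denoting by $H_0:\mathbb{R}^n\times Y\to\mathbb{R}^n\times Y$ the biLipschitz map $H_0(x,y)=(x+h_0(y),y)$, every element of $H_0\Gamma H_0^{-1}\subset\mathrm{Homeo}(\mathbb{R}^n\times Y)$ is a similarity.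
   Context: $|\cdot|$ is the Euclidean norm on $\mathbb{R}^n$, and $(\mathbb{R}^n,|\cdot|^\beta)$ denotes $\mathbb{R}^n$ with the metric $|p-q|^\beta$. $\mathbb{R}_+$ is the set of positive reals. A map $f:(X,d)\to(X,d)$ is a similarity if there is a constant $c_f>0$ with $d(f(x),f(x'))=c_f\,d(x,x')$ for all $x,x'\in X$. A bijection $F:(X,d)\to(X,d)$ is an $(M,C)$-quasisimilarity ($M\ge1$, $C>0$) if $\frac{C}{M}d(x_1,x_2)\le d(F(x_1),F(x_2))\le MC\,d(x_1,x_2)$ for all $x_1,x_2\in X$. $\Gamma$ is a uniform quasisimilarity group if there is some $M\ge1$ such that every $\gamma\in\Gamma$ acts as an $(M,C_\gamma)$-quasisimilarity, where $C_\gamma>0$ may depend on $\gamma$. *)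

theory Defs
  imports "HOL-Analysis.Analysis" "HOL-Algebra.Group_Action"
begin

section \<open>Snowflakes and maximum products\<close>

text \<open>The abstract type of metrics is used because neither the snowflake distance nor the
  maximum distance is the one attached to the type by its class instance. Outside
  \<open>0 < \<beta> \<le> 1\<close> the metric \<open>snowflake_metric \<beta>\<close> is unspecified.\<close>

definition snowflake_metric :: "real \<Rightarrow> 'a::real_normed_vector metric"
  where "snowflake_metric \<beta> = metric (UNIV, \<lambda>p q. norm (p - q) powr \<beta>)"

definition max_metric :: "'a metric \<Rightarrow> 'b metric \<Rightarrow> ('a \<times> 'b) metric"
  where "max_metric m1 m2 = metric (mspace m1 \<times> mspace m2,
    \<lambda>p q. max (mdist m1 (fst p) (fst q)) (mdist m2 (snd p) (snd q)))"

lemma powr_subadditive: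
  fixes a b \<beta> :: real
  assumes "0 \<le> a" "0 \<le> b" "0 < \<beta>" "\<beta> \<le> 1"
  shows "(a + b) powr \<beta> \<le> a powr \<beta> + b powr \<beta>"
proof (cases "a + b = 0")
  case False
  define s where "s = a + b"
  have s: "s > 0" using False assms by (simp add: s_def)
  have *: "t / s * s powr \<beta> \<le> t powr \<beta>" if t: "0 \<le> t" "t \<le> s" for t
  proof -
    have "(t / s) powr 1 \<le> (t / s) powr \<beta>"
      using t s assms by (intro powr_mono') auto
    then have "t / s \<le> (t / s) powr \<beta>" using t s by simp
    then have "t / s * s powr \<beta> \<le> (t / s) powr \<beta> * s powr \<beta>"
      by (intro mult_right_mono) auto
    also have "\<dots> = t powr \<beta>" using t s by (simp add: powr_divide)
    finally show ?thesis .
  qed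
  have "s powr \<beta> = a / s * s powr \<beta> + b / s * s powr \<beta>"
    using s by (simp add: s_def flip: distrib_right add_divide_distrib)
  also have "\<dots> \<le> a powr \<beta> + b powr \<beta>"
    using assms by (intro add_mono *) (auto simp: s_def)
  finally show ?thesis by (simp add: s_def)
qed (use assms in auto)

lemma Metric_space_snowflake:
  assumes "0 < \<beta>" "\<beta> \<le> 1"
  shows "Metric_space UNIV (\<lambda>p q :: 'a::real_normed_vector. norm (p - q) powr \<beta>)"
proof
  fix x y z :: 'a
  have "norm (x - z) powr \<beta> \<le> (norm (x - y) + norm (y - z)) powr \<beta>"
    using assms norm_triangle_ineq[of "x - y" "y - z"] by (intro powr_mono2) auto
  also have "\<dots> \<le> norm (x - y) powr \<beta> + norm (y - z) powr \<beta>"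
    using assms by (intro powr_subadditive) auto
  finally show "norm (x - z) powr \<beta> \<le> norm (x - y) powr \<beta> + norm (y - z) powr \<beta>" .
qed (auto simp: norm_minus_commute)

lemma mspace_snowflake_metric:
  assumes "0 < \<beta>" "\<beta> \<le> 1"
  shows "mspace (snowflake_metric \<beta>) = UNIV"
  unfolding snowflake_metric_def
  by (rule Metric_space.mspace_metric[OF Metric_space_snowflake[OF assms]])

lemma mdist_snowflake_metric:
  assumes "0 < \<beta>" "\<beta> \<le> 1"
  shows "mdist (snowflake_metric \<beta>) p q = norm (p - q) powr \<beta>"
  unfolding snowflake_metric_def
  by (simp add: Metric_space.mdist_metric[OF Metric_space_snowflake[OF assms]])

lemma Metric_space_max:
  "Metric_space (mspace m1 \<times> mspace m2)
    (\<lambda>p q. max (mdist m1 (fst p) (fst q)) (mdist m2 (snd p) (snd q)))"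
proof
  fix p q r assume "p \<in> mspace m1 \<times> mspace m2" "q \<in> mspace m1 \<times> mspace m2"
    "r \<in> mspace m1 \<times> mspace m2"
  then have "mdist m1 (fst p) (fst r) \<le> mdist m1 (fst p) (fst q) + mdist m1 (fst q) (fst r)"
    "mdist m2 (snd p) (snd r) \<le> mdist m2 (snd p) (snd q) + mdist m2 (snd q) (snd r)"
    by (auto intro!: mdist_triangle)
  then show "max (mdist m1 (fst p) (fst r)) (mdist m2 (snd p) (snd r))
    \<le> max (mdist m1 (fst p) (fst q)) (mdist m2 (snd p) (snd q))
      + max (mdist m1 (fst q) (fst r)) (mdist m2 (snd q) (snd r))"
    by linarith
next
  fix p q assume "p \<in> mspace m1 \<times> mspace m2" "q \<in> mspace m1 \<times> mspace m2"
  then have "mdist m1 (fst p) (fst q) = 0 \<longleftrightarrow> fst p = fst q"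
    "mdist m2 (snd p) (snd q) = 0 \<longleftrightarrow> snd p = snd q"
    by auto
  moreover have "0 \<le> mdist m1 (fst p) (fst q)" "0 \<le> mdist m2 (snd p) (snd q)"
    by auto
  ultimately show "max (mdist m1 (fst p) (fst q)) (mdist m2 (snd p) (snd q)) = 0 \<longleftrightarrow> p = q"
    by (metis max.absorb_iff2 max.cobounded1 max.cobounded2 order_antisym prod_eq_iff)
qed (auto simp: mdist_commute le_max_iff_disj)

lemma mspace_max_metric [simp]: "mspace (max_metric m1 m2) = mspace m1 \<times> mspace m2"
  by (simp add: max_metric_def Metric_space.mspace_metric[OF Metric_space_max])

lemma mdist_max_metric:
  "mdist (max_metric m1 m2) p q = max (mdist m1 (fst p) (fst q)) (mdist m2 (snd p) (snd q))"
  by (simp add: max_metric_def Metric_space.mdist_metric[OF Metric_space_max])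

definition snowflake_product :: "real \<Rightarrow> ((real^'n) \<times> 'y::metric_space) metric"
  where "snowflake_product \<beta> = max_metric (snowflake_metric \<beta>) euclidean_metric"

lemma mdist_snowflake_product:
  assumes "0 < \<beta>" "\<beta> \<le> 1"
  shows "mdist (snowflake_product \<beta>) (x1, y1) (x2, y2)
    = max (norm (x1 - x2) powr \<beta>) (dist y1 y2)"
  using assms by (simp add: snowflake_product_def mdist_max_metric mdist_snowflake_metric)

section \<open>Classes of maps\<close>

definition similarity :: "'a metric \<Rightarrow> ('a \<Rightarrow> 'a) \<Rightarrow> bool"
  where "similarity m f \<longleftrightarrow> f \<in> mspace m \<rightarrow> mspace m \<and>
    (\<exists>c>0. \<forall>x\<in>mspace m. \<forall>x'\<in>mspace m. mdist m (f x) (f x') = c * mdist m x x')"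

definition quasisimilarity :: "'a metric \<Rightarrow> real \<Rightarrow> real \<Rightarrow> ('a \<Rightarrow> 'a) \<Rightarrow> bool"
  where "quasisimilarity m M C F \<longleftrightarrow> M \<ge> 1 \<and> C > 0 \<and> bij_betw F (mspace m) (mspace m) \<and>
    (\<forall>x1\<in>mspace m. \<forall>x2\<in>mspace m.
      C / M * mdist m x1 x2 \<le> mdist m (F x1) (F x2) \<and>
      mdist m (F x1) (F x2) \<le> M * C * mdist m x1 x2)"

definition bilipschitz :: "'a metric \<Rightarrow> ('a \<Rightarrow> 'a) \<Rightarrow> bool"
  where "bilipschitz m F \<longleftrightarrow> bij_betw F (mspace m) (mspace m) \<and>
    (\<exists>L\<ge>1. \<forall>x1\<in>mspace m. \<forall>x2\<in>mspace m.
      1 / L * mdist m x1 x2 \<le> mdist m (F x1) (F x2) \<and>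
      mdist m (F x1) (F x2) \<le> L * mdist m x1 x2)"

definition pointed_lipschitz_maps :: "real \<Rightarrow> 'y::metric_space \<Rightarrow> ('y \<Rightarrow> real^'n) set"
  where "pointed_lipschitz_maps \<beta> y0 =
    {h. Lipschitz_continuous_map euclidean_metric (snowflake_metric \<beta>) h \<and> h y0 = 0}"

section \<open>Amenable locally compact groups and their actions\<close>

locale locally_compact_group = group G for G (structure) and T :: "'g topology" +
  assumes topspace_eq: "topspace T = carrier G"
    and continuous_mult: "continuous_map (prod_topology T T) T (\<lambda>(x, y). x \<otimes> y)"
    and continuous_inv: "continuous_map T T (\<lambda>x. inv x)"
    and Hausdorff: "Hausdorff_space T"
    and locally_compact: "locally_compact_space T"

definition bounded_continuous_functions :: "'g topology \<Rightarrow> ('g \<Rightarrow> real) set"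
  where "bounded_continuous_functions T =
    {f. continuous_map T euclideanreal f \<and> bounded (f ` topspace T)}"

text \<open>Amenability as the existence of a left invariant mean on the bounded continuous
  functions; for locally compact groups this is equivalent to the existence of a left invariant
  mean on the essentially bounded functions with respect to Haar measure. By positivity and linearity the
  value of a mean at \<open>f\<close> depends only on the restriction of \<open>f\<close> to the group.\<close>

definition amenable :: "('g, 'k) monoid_scheme \<Rightarrow> 'g topology \<Rightarrow> bool"
  where "amenable G T \<longleftrightarrow> (\<exists>\<mu> :: ('g \<Rightarrow> real) \<Rightarrow> real.
    (\<forall>f\<in>bounded_continuous_functions T. \<forall>g\<in>bounded_continuous_functions T.
      \<mu> (\<lambda>x. f x + g x) = \<mu> f + \<mu> g) \<and>
    (\<forall>c. \<forall>f\<in>bounded_continuous_functions T. \<mu> (\<lambda>x. c * f x) = c * \<mu> f) \<and>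
    (\<forall>f\<in>bounded_continuous_functions T. (\<forall>x\<in>carrier G. 0 \<le> f x) \<longrightarrow> 0 \<le> \<mu> f) \<and>
    \<mu> (\<lambda>x. 1) = 1 \<and>
    (\<forall>f\<in>bounded_continuous_functions T. \<forall>g\<in>carrier G. \<mu> (\<lambda>x. f (g \<otimes>\<^bsub>G\<^esub> x)) = \<mu> f))"

definition continuous_action ::
    "('g, 'k) monoid_scheme \<Rightarrow> 'g topology \<Rightarrow> 'a metric \<Rightarrow> ('g \<Rightarrow> 'a \<Rightarrow> 'a) \<Rightarrow> bool"
  where "continuous_action G T m \<phi> \<longleftrightarrow> group_action G (mspace m) \<phi> \<and>
    continuous_map (prod_topology T (mtopology_of m)) (mtopology_of m) (\<lambda>(g, p). \<phi> g p)"

definition uniform_quasisimilarity_group ::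
    "('g, 'k) monoid_scheme \<Rightarrow> 'a metric \<Rightarrow> ('g \<Rightarrow> 'a \<Rightarrow> 'a) \<Rightarrow> bool"
  where "uniform_quasisimilarity_group G m \<phi> \<longleftrightarrow>
    (\<exists>M\<ge>1. \<forall>g\<in>carrier G. \<exists>C>0. quasisimilarity m M C (\<phi> g))"

definition shear :: "('y \<Rightarrow> real^'n) \<Rightarrow> (real^'n) \<times> 'y \<Rightarrow> (real^'n) \<times> 'y"
  where "shear h = (\<lambda>(x, y). (x + h y, y))"

end

theory Submission
  imports Defs
begin

text \<open>Write \<open>\<gamma>(x, y) = (N\<^sub>\<gamma>(x + k\<^sub>\<gamma>(y)), \<sigma>\<^sub>\<gamma>(y))\<close> with \<open>N\<^sub>\<gamma> = a\<^sub>\<gamma> A\<^sub>\<gamma>\<close>, and \<open>h\<^sub>\<gamma> = k\<^sub>\<gamma> - k\<^sub>\<gamma>(y\<^sub>0)\<close>. Uniform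
  quasisimilarity bounds the Lipschitz constants of all \<open>h\<^sub>\<gamma>\<close> by \<open>M\<^sup>2\<close>, and applied to the powers of
  \<open>\<gamma>\<close> and of its inverse it forces \<open>\<sigma>\<^sub>\<gamma>\<close> to have ratio exactly \<open>a\<^sub>\<gamma>\<^sup>\<beta>\<close>. Since
  \<open>N\<^sub>\<delta>(h\<^sub>\<gamma>\<^sub>\<delta> - h\<^sub>\<delta>) = h\<^sub>\<gamma> \<circ> \<sigma>\<^sub>\<delta> - h\<^sub>\<gamma>(\<sigma>\<^sub>\<delta>(y\<^sub>0))\<close>, the group acts affinely on the maps \<open>h\<close>, and the
  invariant mean of the bounded orbit of \<open>0\<close> is a fixed point \<open>h\<^sub>0\<close>; conjugating by its shear
  removes the dependence of the fibre component on \<open>y\<close>.\<close>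

section \<open>Means of vector-valued functions\<close>

text \<open>Vector-valued, so that closure under bounded linear maps, proved once, yields
  coordinates, scalar multiples and matrix images.\<close>

definition bounded_continuous_maps :: "'g topology \<Rightarrow> ('g \<Rightarrow> 'v::real_normed_vector) set"
  where "bounded_continuous_maps T =
    {f. continuous_map T euclidean f \<and> bounded (f ` topspace T)}"

lemma bounded_continuous_maps_linear:
  assumes F: "F \<in> bounded_continuous_maps T" and L: "bounded_linear L"
  shows "(\<lambda>x. L (F x)) \<in> bounded_continuous_maps T"
proof -
  have "continuous_map euclidean euclidean L"
    using L by (simp add: linear_continuous_on)
  then have "continuous_map T euclidean (L \<circ> F)"
    using F by (auto simp: bounded_continuous_maps_def intro: continuous_map_compose)
  moreover have "bounded (L ` F ` topspace T)"
    using F L by (auto simp: bounded_continuous_maps_def intro: bounded_linear_image)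
  ultimately show ?thesis
    by (simp add: bounded_continuous_maps_def o_def image_image)
qed

lemma bounded_continuous_maps_diff:
  assumes "F \<in> bounded_continuous_maps T" "H \<in> bounded_continuous_maps T"
  shows "(\<lambda>x. F x - H x) \<in> bounded_continuous_maps T"
  using assms by (auto simp: bounded_continuous_maps_def
      intro!: continuous_map_diff bounded_minus_comp)

lemma bounded_continuous_maps_real:
  "bounded_continuous_maps T = bounded_continuous_functions T"
  by (simp add: bounded_continuous_maps_def bounded_continuous_functions_def)

lemma bounded_continuous_maps_component:
  fixes F :: "'g \<Rightarrow> real^'n"
  assumes "F \<in> bounded_continuous_maps T"
  shows "(\<lambda>x. F x $ i) \<in> bounded_continuous_functions T"
  using bounded_continuous_maps_linear[OF assms bounded_linear_vec_nth]
  by (simp add: bounded_continuous_maps_real)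

lemma bounded_continuous_functions_const: "(\<lambda>x. c) \<in> bounded_continuous_functions T"
  by (auto simp: bounded_continuous_functions_def image_constant_conv)

lemma bounded_continuous_functions_scale:
  assumes "f \<in> bounded_continuous_functions T"
  shows "(\<lambda>x. c * f x) \<in> bounded_continuous_functions T"
  using bounded_continuous_maps_linear[of f T "\<lambda>x. c * x"] assms bounded_linear_mult_right
  by (auto simp: bounded_continuous_maps_real)

lemma bounded_continuous_functions_add:
  assumes "f \<in> bounded_continuous_functions T" "g \<in> bounded_continuous_functions T"
  shows "(\<lambda>x. f x + g x) \<in> bounded_continuous_functions T"
  using assms by (auto simp: bounded_continuous_functions_def
      intro!: continuous_map_add bounded_plus_comp)

lemma bounded_continuous_functions_sum:
  assumes "finite I" "\<And>i. i \<in> I \<Longrightarrow> f i \<in> bounded_continuous_functions T"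
  shows "(\<lambda>x. \<Sum>i\<in>I. f i x) \<in> bounded_continuous_functions T"
  using assms
  by (induction I) (auto simp: bounded_continuous_functions_const bounded_continuous_functions_add)

locale invariant_mean = locally_compact_group G T for G (structure) and T +
  fixes \<mu> :: "('g \<Rightarrow> real) \<Rightarrow> real"
  assumes add: "\<lbrakk>f \<in> bounded_continuous_functions T; f' \<in> bounded_continuous_functions T\<rbrakk>
      \<Longrightarrow> \<mu> (\<lambda>x. f x + f' x) = \<mu> f + \<mu> f'"
    and scale: "f \<in> bounded_continuous_functions T \<Longrightarrow> \<mu> (\<lambda>x. c * f x) = c * \<mu> f"
    and nonneg: "\<lbrakk>f \<in> bounded_continuous_functions T; \<And>x. x \<in> carrier G \<Longrightarrow> 0 \<le> f x\<rbrakk>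
      \<Longrightarrow> 0 \<le> \<mu> f"
    and one: "\<mu> (\<lambda>x. 1) = 1"
    and invariant: "\<lbrakk>f \<in> bounded_continuous_functions T; g \<in> carrier G\<rbrakk>
      \<Longrightarrow> \<mu> (\<lambda>x. f (g \<otimes> x)) = \<mu> f"
begin

lemma const: "\<mu> (\<lambda>x. c) = c"
  using scale[OF bounded_continuous_functions_const, of c 1] one by simp

lemma mono:
  assumes "f \<in> bounded_continuous_functions T" "g \<in> bounded_continuous_functions T"
    and "\<And>x. x \<in> carrier G \<Longrightarrow> f x \<le> g x"
  shows "\<mu> f \<le> \<mu> g"
proof -
  have f: "(\<lambda>x. -1 * f x) \<in> bounded_continuous_functions T"
    using assms(1) by (rule bounded_continuous_functions_scale)
  have "0 \<le> \<mu> (\<lambda>x. g x + -1 * f x)"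
    using assms f by (intro nonneg bounded_continuous_functions_add) auto
  also have "\<dots> = \<mu> g - \<mu> f"
    using add[OF assms(2) f] scale[OF assms(1), of "-1"] by simp
  finally show ?thesis by simp
qed

text \<open>Positivity is tested on \<open>carrier G\<close> only, so the mean ignores values
  outside the group; the cocycle identities are available only inside it.\<close>

lemma cong:
  assumes "f \<in> bounded_continuous_functions T" "g \<in> bounded_continuous_functions T"
    and "\<And>x. x \<in> carrier G \<Longrightarrow> f x = g x"
  shows "\<mu> f = \<mu> g"
  using assms by (intro antisym mono) auto

lemma abs_le:
  assumes "f \<in> bounded_continuous_functions T" "\<And>x. x \<in> carrier G \<Longrightarrow> \<bar>f x\<bar> \<le> B"
  shows "\<bar>\<mu> f\<bar> \<le> B"
proof -
  have "\<mu> f \<le> B"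
    using assms mono[of f "\<lambda>_. B"] by (force simp: const bounded_continuous_functions_const)
  moreover have "-B \<le> \<mu> f"
    using assms mono[of "\<lambda>_. -B" f] by (force simp: const bounded_continuous_functions_const)
  ultimately show ?thesis by simp
qed

lemma sum:
  assumes "finite I" "\<And>i. i \<in> I \<Longrightarrow> f i \<in> bounded_continuous_functions T"
  shows "\<mu> (\<lambda>x. \<Sum>i\<in>I. f i x) = (\<Sum>i\<in>I. \<mu> (f i))"
  using assms
  by (induction I) (auto simp: const add bounded_continuous_functions_sum)

definition vector_mean :: "('g \<Rightarrow> real^'n) \<Rightarrow> real^'n"
  where "vector_mean F = (\<chi> i. \<mu> (\<lambda>x. F x $ i))"

lemma vector_mean_cong:
  assumes "F \<in> bounded_continuous_maps T" "H \<in> bounded_continuous_maps T"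
    and "\<And>x. x \<in> carrier G \<Longrightarrow> F x = H x"
  shows "vector_mean F = vector_mean H"
  unfolding vector_mean_def vec_eq_iff
  using assms by (auto intro!: cong bounded_continuous_maps_component)

lemma vector_mean_const: "vector_mean (\<lambda>x. v) = v"
  by (simp add: vector_mean_def const)

lemma vector_mean_diff:
  assumes "F \<in> bounded_continuous_maps T" "H \<in> bounded_continuous_maps T"
  shows "vector_mean (\<lambda>x. F x - H x) = vector_mean F - vector_mean H"
proof -
  have "\<mu> (\<lambda>x. F x $ i + -1 * H x $ i) = \<mu> (\<lambda>x. F x $ i) + \<mu> (\<lambda>x. -1 * H x $ i)" for i
    using assms
    by (intro add bounded_continuous_functions_scale bounded_continuous_maps_component)
  moreover have "\<mu> (\<lambda>x. -1 * H x $ i) = -1 * \<mu> (\<lambda>x. H x $ i)" for i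
    using assms(2) by (intro scale bounded_continuous_maps_component)
  ultimately show ?thesis by (simp add: vector_mean_def vec_eq_iff)
qed

lemma vector_mean_matrix_mult:
  fixes F :: "'g \<Rightarrow> real^'n"
  assumes "F \<in> bounded_continuous_maps T"
  shows "vector_mean (\<lambda>x. A *v F x) = A *v vector_mean F"
  using assms
  by (simp add: vector_mean_def vec_eq_iff matrix_vector_mult_def sum scale
      bounded_continuous_functions_scale bounded_continuous_maps_component)

text \<open>Estimating each coordinate and passing through the l1 norm costs the factor
  \<open>CARD('n)\<close>, which is harmless: the averaged map needs only some Lipschitz
  constant.\<close>

lemma norm_vector_mean_le:
  fixes F :: "'g \<Rightarrow> real^'n" and B :: real
  assumes "F \<in> bounded_continuous_maps T" "\<And>x. x \<in> carrier G \<Longrightarrow> norm (F x) \<le> B"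
  shows "norm (vector_mean F) \<le> CARD('n) * B"
proof -
  have "norm (vector_mean F) \<le> (\<Sum>i\<in>UNIV. \<bar>vector_mean F $ i\<bar>)"
    by (rule norm_le_l1_cart)
  also have "\<dots> \<le> (\<Sum>i\<in>(UNIV::'n set). B)"
  proof (rule sum_mono)
    fix i
    have "\<bar>F x $ i\<bar> \<le> B" if "x \<in> carrier G" for x
      using component_le_norm_cart[of "F x" i] assms(2)[OF that] by linarith
    then show "\<bar>vector_mean F $ i\<bar> \<le> B"
      using assms(1) by (simp add: vector_mean_def abs_le bounded_continuous_maps_component)
  qed
  finally show ?thesis by simp
qed

lemma vector_mean_invariant:
  assumes "F \<in> bounded_continuous_maps T" "g \<in> carrier G"
  shows "vector_mean (\<lambda>x. F (g \<otimes> x)) = vector_mean F"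
  using invariant[OF bounded_continuous_maps_component[OF assms(1)] assms(2)]
  by (simp add: vector_mean_def vec_eq_iff)

lemma bounded_continuous_maps_translate:
  assumes F: "F \<in> bounded_continuous_maps T" and g: "g \<in> carrier G"
  shows "(\<lambda>x. F (g \<otimes> x)) \<in> bounded_continuous_maps T"
proof -
  have "continuous_map T (prod_topology T T) (\<lambda>x. (g, x))"
    using g by (intro continuous_map_pairedI) (auto simp: topspace_eq)
  from continuous_map_compose[OF this continuous_mult]
  have "continuous_map T T (\<lambda>x. g \<otimes> x)" by (simp add: o_def)
  moreover from this have "continuous_map T euclidean (F \<circ> (\<lambda>x. g \<otimes> x))"
    using F by (intro continuous_map_compose) (auto simp: bounded_continuous_maps_def)
  moreover have "(\<lambda>x. F (g \<otimes> x)) ` topspace T \<subseteq> F ` topspace T"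
    using g by (auto simp: topspace_eq)
  ultimately show ?thesis
    using F by (auto simp: bounded_continuous_maps_def o_def intro: bounded_subset)
qed

end

lemma (in locally_compact_group) amenableE:
  assumes "amenable G T"
  obtains \<mu> where "invariant_mean G T \<mu>"
  using assms unfolding amenable_def
proof (elim exE conjE)
  fix \<mu> :: "('g \<Rightarrow> real) \<Rightarrow> real"
  assume invariant: "\<forall>f\<in>bounded_continuous_functions T. \<forall>g\<in>carrier G. \<mu> (\<lambda>x. f (g \<otimes> x)) = \<mu> f"
    and "\<forall>f\<in>bounded_continuous_functions T. \<forall>g\<in>bounded_continuous_functions T.
      \<mu> (\<lambda>x. f x + g x) = \<mu> f + \<mu> g"
    "\<forall>c. \<forall>f\<in>bounded_continuous_functions T. \<mu> (\<lambda>x. c * f x) = c * \<mu> f"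
    "\<forall>f\<in>bounded_continuous_functions T. (\<forall>x\<in>carrier G. 0 \<le> f x) \<longrightarrow> 0 \<le> \<mu> f"
    "\<mu> (\<lambda>x. 1) = 1"
  then have "invariant_mean G T \<mu>"
    by unfold_locales (simp_all del: invariant add: bspec[OF bspec[OF invariant]])
  then show thesis by (rule that)
qed

section \<open>The snowflake product\<close>

lemma mspace_snowflake_product:
  assumes "0 < \<beta>" "\<beta> \<le> 1"
  shows "mspace (snowflake_product \<beta> :: ((real^'n) \<times> 'y::metric_space) metric) = UNIV"
  using assms by (simp add: snowflake_product_def mspace_snowflake_metric)

lemma continuous_map_snowflake_product_snd:
  assumes "0 < \<beta>" "\<beta> \<le> 1"
  shows "continuous_map
    (mtopology_of (snowflake_product \<beta> :: ((real^'n) \<times> 'y::metric_space) metric)) euclidean snd"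
proof -
  have "Lipschitz_continuous_map
      (snowflake_product \<beta> :: ((real^'n) \<times> 'y::metric_space) metric) euclidean_metric snd"
    using assms unfolding Lipschitz_continuous_map_def
    by (auto simp: mspace_snowflake_product mdist_snowflake_product intro!: exI[of _ 1])
  from Lipschitz_continuous_imp_continuous_map[OF this] show ?thesis by simp
qed

text \<open>For \<open>\<beta> < 1\<close> this projection fails to be Lipschitz at large distances,
  but \<open>\<epsilon> powr \<beta>\<close> is a uniform modulus.\<close>

lemma continuous_map_snowflake_product_fst:
  assumes "0 < \<beta>" "\<beta> \<le> 1"
  shows "continuous_map
    (mtopology_of (snowflake_product \<beta> :: ((real^'n) \<times> 'y::metric_space) metric)) euclidean fst"
proof -
  have "uniformly_continuous_map
      (snowflake_product \<beta> :: ((real^'n) \<times> 'y::metric_space) metric) euclidean_metric fst"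
    unfolding uniformly_continuous_map_def
  proof (intro conjI allI impI)
    fix \<epsilon> :: real assume \<epsilon>: "\<epsilon> > 0"
    have "dist x1 x2 < \<epsilon>" if "max (norm (x1 - x2) powr \<beta>) (dist y1 y2) < \<epsilon> powr \<beta>"
      for x1 x2 :: "real^'n" and y1 y2 :: 'y
      using that powr_less_cancel2[of \<beta> "norm (x1 - x2)" \<epsilon>] assms \<epsilon>
      by (cases "x1 = x2") (auto simp: dist_norm)
    then show "\<exists>\<delta>>0. \<forall>x\<in>mspace (snowflake_product \<beta> :: ((real^'n) \<times> 'y) metric).
        \<forall>y\<in>mspace (snowflake_product \<beta>).
          mdist (snowflake_product \<beta>) y x < \<delta> \<longrightarrow> mdist euclidean_metric (fst y) (fst x) < \<epsilon>"
      using assms \<epsilon> by (auto simp: mdist_snowflake_product intro!: exI[of _ "\<epsilon> powr \<beta>"])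
  qed auto
  from uniformly_continuous_imp_continuous_map[OF this] show ?thesis by simp
qed

text \<open>An isometric embedding; it supplies the moving points \<open>(0, u g)\<close> at which
  the action is evaluated in \<open>continuous_map_k_inv\<close>.\<close>

lemma continuous_map_snowflake_product_fibre:
  assumes "0 < \<beta>" "\<beta> \<le> 1"
  shows "continuous_map euclidean
    (mtopology_of (snowflake_product \<beta> :: ((real^'n) \<times> 'y::metric_space) metric)) (\<lambda>y. (x, y))"
proof -
  have "Lipschitz_continuous_map euclidean_metric
      (snowflake_product \<beta> :: ((real^'n) \<times> 'y::metric_space) metric) (\<lambda>y. (x, y))"
    using assms unfolding Lipschitz_continuous_map_def
    by (auto simp: mspace_snowflake_product mdist_snowflake_product intro!: exI[of _ 1])
  from Lipschitz_continuous_imp_continuous_map[OF this] show ?thesis by simp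
qed

section \<open>Shears and their Lipschitz constants\<close>

lemma shear_uminus_shear: "shear (\<lambda>y. - h y) (shear h p) = p" "shear h (shear (\<lambda>y. - h y) p) = p"
  by (cases p; simp add: shear_def)+

lemma bij_shear: "bij (shear h)"
  by (rule o_bij[of "shear (\<lambda>y. - h y)"]) (auto simp: shear_uminus_shear)

lemma inv_shear: "inv_into UNIV (shear h) = shear (\<lambda>y. - h y)"
  by (rule inv_equality) (auto simp: shear_uminus_shear)

text \<open>Triangle inequality and subadditivity of \<open>t powr \<beta>\<close>. Only differences
  of \<open>h\<close> are bounded, so the estimate also covers \<open>- h\<close> with the same
  \<open>K\<close>.\<close>

lemma mdist_shear_le:
  fixes h :: "'y::metric_space \<Rightarrow> real^'n"
  assumes \<beta>: "0 < \<beta>" "\<beta> \<le> 1" and K: "K \<ge> 0"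
    and h: "\<And>y1 y2. norm (h y1 - h y2) powr \<beta> \<le> K * dist y1 y2"
  shows "mdist (snowflake_product \<beta>) (shear h p) (shear h q)
    \<le> (1 + K) * mdist (snowflake_product \<beta>) p q"
proof -
  obtain x1 y1 x2 y2 where pq: "p = (x1, y1)" "q = (x2, y2)" by fastforce
  let ?m = "max (norm (x1 - x2) powr \<beta>) (dist y1 y2)"
  have "norm (x1 + h y1 - (x2 + h y2)) powr \<beta> \<le> (norm (x1 - x2) + norm (h y1 - h y2)) powr \<beta>"
    using \<beta> norm_triangle_ineq[of "x1 - x2" "h y1 - h y2"]
    by (intro powr_mono2) (auto simp: algebra_simps)
  also have "\<dots> \<le> norm (x1 - x2) powr \<beta> + norm (h y1 - h y2) powr \<beta>"
    using \<beta> by (intro powr_subadditive) auto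
  also have "\<dots> \<le> ?m + K * ?m"
    using K by (intro add_mono order_trans[OF h] mult_left_mono) auto
  finally have "norm (x1 + h y1 - (x2 + h y2)) powr \<beta> \<le> (1 + K) * ?m"
    by (simp add: algebra_simps)
  moreover have "dist y1 y2 \<le> (1 + K) * ?m"
  proof -
    have "0 \<le> K * ?m" using K by (intro mult_nonneg_nonneg) (auto simp: le_max_iff_disj)
    then show ?thesis by (simp add: distrib_right)
  qed
  ultimately show ?thesis
    using \<beta> by (simp add: pq shear_def mdist_snowflake_product)
qed

lemma pointed_lipschitz_mapsE:
  fixes h :: "'y::metric_space \<Rightarrow> real^'n"
  assumes "0 < \<beta>" "\<beta> \<le> 1" "h \<in> pointed_lipschitz_maps \<beta> y0"
  obtains K where "K \<ge> 0" "\<And>y1 y2. norm (h y1 - h y2) powr \<beta> \<le> K * dist y1 y2"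
proof -
  from assms obtain K where "K > 0" "\<And>y1 y2. norm (h y1 - h y2) powr \<beta> \<le> K * dist y1 y2"
    by (auto simp: pointed_lipschitz_maps_def Lipschitz_continuous_map_pos mdist_snowflake_metric)
  then show thesis by (intro that[of K]) auto
qed

text \<open>The inverse of a shear is the shear by \<open>- h\<close>, so the upper estimate applied
  to both gives the two-sided one.\<close>

lemma bilipschitz_shear:
  fixes h :: "'y::metric_space \<Rightarrow> real^'n"
  assumes \<beta>: "0 < \<beta>" "\<beta> \<le> 1" and h: "h \<in> pointed_lipschitz_maps \<beta> y0"
  shows "bilipschitz (snowflake_product \<beta>) (shear h)"
proof -
  obtain K where K: "K \<ge> 0" "\<And>y1 y2. norm (h y1 - h y2) powr \<beta> \<le> K * dist y1 y2"
    using pointed_lipschitz_mapsE[OF assms] by blast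
  have K': "norm (- h y1 - - h y2) powr \<beta> \<le> K * dist y1 y2" for y1 y2
    using K(2)[of y2 y1] by (simp add: dist_commute)
  have "mdist (snowflake_product \<beta>) p q
      \<le> (1 + K) * mdist (snowflake_product \<beta>) (shear h p) (shear h q)" for p q
    using mdist_shear_le[OF \<beta> K(1) K', of "shear h p" "shear h q"]
    by (simp add: shear_uminus_shear)
  then have "1 / (1 + K) * mdist (snowflake_product \<beta>) p q
      \<le> mdist (snowflake_product \<beta>) (shear h p) (shear h q)" for p q
    using K(1) by (simp add: pos_divide_le_eq mult.commute)
  then show ?thesis
    unfolding bilipschitz_def mspace_snowflake_product[OF \<beta>]
    using mdist_shear_le[OF \<beta> K] K(1) bij_shear by (intro conjI exI[of _ "1 + K"] ballI) simp_all
qed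

section \<open>Actions by fibrewise similarities\<close>

text \<open>In the notation of the theorem, \<open>N g = a\<^sub>g A\<^sub>g\<close> and \<open>k g y = x\<^sub>g + h\<^sub>g(y)\<close>.\<close>

locale fibre_similarity_action = group_action G UNIV \<phi>
  for G (structure) and \<phi> :: "'g \<Rightarrow> (real^'n) \<times> 'y::metric_space \<Rightarrow> (real^'n) \<times> 'y" +
  fixes a :: "'g \<Rightarrow> real" and N :: "'g \<Rightarrow> real^'n^'n" and k :: "'g \<Rightarrow> 'y \<Rightarrow> real^'n"
    and \<sigma> :: "'g \<Rightarrow> 'y \<Rightarrow> 'y"
  assumes action_eq: "g \<in> carrier G \<Longrightarrow> \<phi> g (x, y) = (N g *v (x + k g y), \<sigma> g y)"
    and norm_N: "g \<in> carrier G \<Longrightarrow> norm (N g *v x) = a g * norm x"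
    and a_pos: "g \<in> carrier G \<Longrightarrow> a g > 0"
    and similarity_\<sigma>: "g \<in> carrier G \<Longrightarrow> similarity euclidean_metric (\<sigma> g)"
begin

sublocale group G
  using group_hom by (rule group_hom.axioms)

section \<open>Multiplicativity and the cocycle identity\<close>

lemma mult_action:
  assumes "g \<in> carrier G" "d \<in> carrier G"
  shows "N (g \<otimes> d) *v (x + k (g \<otimes> d) y) = N g *v (N d *v (x + k d y) + k g (\<sigma> d y))"
    and \<sigma>_mult: "\<sigma> (g \<otimes> d) y = \<sigma> g (\<sigma> d y)"
  using composition_rule[of "(x, y)" g d] assms by (auto simp: action_eq)

lemma inj_N:
  assumes "g \<in> carrier G" "N g *v x = N g *v x'"
  shows "x = x'"
  using norm_N[of g "x - x'"] a_pos[of g] assms by (simp add: matrix_vector_mult_diff_distrib)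

text \<open>Subtracting the composition rule at \<open>0\<close> from the one at \<open>x\<close>,
  over the same \<open>y\<close>, removes the cocycle terms.\<close>

lemma N_mult:
  assumes "g \<in> carrier G" "d \<in> carrier G"
  shows "N (g \<otimes> d) *v x = N g *v (N d *v x)"
  using mult_action(1)[OF assms, of x y] mult_action(1)[OF assms, of 0 y]
  by (simp add: matrix_vector_right_distrib)

lemma a_mult:
  assumes "g \<in> carrier G" "d \<in> carrier G"
  shows "a (g \<otimes> d) = a g * a d"
proof -
  obtain x :: "real^'n" where "norm x = 1"
    using vector_choose_size[of 1] by auto
  then show ?thesis
    using norm_N[of "g \<otimes> d" x] assms by (simp add: N_mult norm_N)
qed

lemma a_one: "a \<one> = 1"
  using a_mult[of \<one> \<one>] a_pos[of \<one>] by simp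

lemma a_pow: "g \<in> carrier G \<Longrightarrow> a (g [^] (n::nat)) = a g ^ n"
  by (induction n) (auto simp: a_one a_mult)

lemma \<sigma>_one: "\<sigma> \<one> y = y"
proof -
  have "\<phi> \<one> (0, y) = (0, y)"
    using id_eq_one by (metis UNIV_I restrict_apply')
  then show ?thesis by (simp add: action_eq)
qed

text \<open>At the point \<open>x = - k d y\<close> the inner translation of the composition rule
  vanishes; then the injective \<open>N g\<close> cancels.\<close>

lemma k_mult:
  assumes "g \<in> carrier G" "d \<in> carrier G"
  shows "N d *v (k (g \<otimes> d) y - k d y) = k g (\<sigma> d y)"
proof (rule inj_N[OF assms(1)])
  show "N g *v (N d *v (k (g \<otimes> d) y - k d y)) = N g *v k g (\<sigma> d y)"
    using mult_action(1)[OF assms, of "- k d y" y]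
    by (simp add: flip: N_mult[OF assms])
qed

text \<open>The point \<open>(- k g y, y)\<close> is the preimage of \<open>(0, \<sigma> g y)\<close> under \<open>\<phi> g\<close>; this expresses the
  cocycle by the action alone, so that its continuity is inherited.\<close>

lemma k_inv_eq:
  assumes "g \<in> carrier G"
  shows "k (inv g) y = - fst (\<phi> g (0, snd (\<phi> (inv g) (0, y))))"
proof -
  have "\<phi> (inv g) (- k (inv g) y, y) = (0, \<sigma> (inv g) y)"
    using assms by (simp add: action_eq)
  then have "\<phi> g (0, \<sigma> (inv g) y) = (- k (inv g) y, y)"
    using orbit_sym_aux[of "inv g" "(- k (inv g) y, y)"] assms by simp
  then show ?thesis using assms by (simp add: action_eq)
qed

text \<open>The formula of \<open>k_inv_eq\<close> composes the action twice with continuous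
  projections and embeddings; inverses appear because the mean will average
  \<open>k (inv g)\<close>.\<close>

lemma continuous_map_k_inv:
  assumes \<beta>: "0 < \<beta>" "\<beta> \<le> 1" and T: "locally_compact_group G T"
    and \<phi>: "continuous_action G T (snowflake_product \<beta>) \<phi>"
  shows "continuous_map T euclidean (\<lambda>g. k (inv g) y)"
proof -
  interpret T: locally_compact_group G T by (rule T)
  let ?X = "mtopology_of (snowflake_product \<beta> :: ((real^'n) \<times> 'y) metric)"
  \<comment> \<open>Group element and point both vary with \<open>g\<close>, so joint continuity of
    the action is used.\<close>
  have act: "continuous_map T ?X (\<lambda>g. \<phi> (s g) (0, u g))"
    if "continuous_map T T s" "continuous_map T euclidean u" for s u
  proof -
    have "continuous_map T ?X (\<lambda>g. (0, u g))"
      using continuous_map_compose[OF that(2) continuous_map_snowflake_product_fibre[OF \<beta>, of 0]]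
      by (simp add: o_def)
    with that(1) have "continuous_map T (prod_topology T ?X) (\<lambda>g. (s g, (0, u g)))"
      by (intro continuous_map_pairedI)
    from continuous_map_compose[OF this, of ?X "\<lambda>(g, p). \<phi> g p"] \<phi> show ?thesis
      by (simp add: continuous_action_def o_def)
  qed
  have "continuous_map T ?X (\<lambda>g. \<phi> (inv g) (0, y))"
    using T.continuous_inv by (intro act) auto
  from continuous_map_compose[OF this continuous_map_snowflake_product_snd[OF \<beta>]]
  have "continuous_map T ?X (\<lambda>g. \<phi> g (0, snd (\<phi> (inv g) (0, y))))"
    by (intro act) (auto simp: o_def)
  from continuous_map_compose[OF this continuous_map_snowflake_product_fst[OF \<beta>]]
  have "continuous_map T euclidean (\<lambda>g. - fst (\<phi> g (0, snd (\<phi> (inv g) (0, y)))))"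
    by (intro continuous_map_minus) (auto simp: o_def)
  then show ?thesis
    by (rule continuous_map_eq) (simp add: T.topspace_eq k_inv_eq)
qed

end

section \<open>Consequences of uniform quasisimilarity\<close>

locale quasisimilar_fibre_action = fibre_similarity_action G \<phi> a N k \<sigma>
  for G (structure) and \<phi> :: "'g \<Rightarrow> (real^'n) \<times> 'y::metric_space \<Rightarrow> (real^'n) \<times> 'y"
    and a N k \<sigma> +
  fixes \<beta> :: real and M :: real
  assumes \<beta>: "0 < \<beta>" "\<beta> \<le> 1" and M: "M \<ge> 1"
    and quasisimilar: "g \<in> carrier G \<Longrightarrow> \<exists>C>0. quasisimilarity (snowflake_product \<beta>) M C (\<phi> g)"
begin

text \<open>The constant of \<open>\<phi> g\<close> is comparable to \<open>a g powr \<beta>\<close>, as one sees on a single fibre.\<close>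

lemma mdist_action_le:
  assumes g: "g \<in> carrier G"
  shows "mdist (snowflake_product \<beta>) (\<phi> g p) (\<phi> g q)
    \<le> M\<^sup>2 * a g powr \<beta> * mdist (snowflake_product \<beta>) p q"
proof -
  obtain C where C: "C > 0" "quasisimilarity (snowflake_product \<beta>) M C (\<phi> g)"
    using quasisimilar[OF g] by blast
  then have lower: "C / M * mdist (snowflake_product \<beta>) p q
        \<le> mdist (snowflake_product \<beta>) (\<phi> g p) (\<phi> g q)"
    and upper: "mdist (snowflake_product \<beta>) (\<phi> g p) (\<phi> g q)
        \<le> M * C * mdist (snowflake_product \<beta>) p q" for p q
    unfolding quasisimilarity_def mspace_snowflake_product[OF \<beta>] by blast+
  obtain x :: "real^'n" where x: "norm x = 1"
    using vector_choose_size[of 1] by auto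
  fix y
  \<comment> \<open>The two points are at distance 1, and in the difference of their images the
    cocycle terms cancel.\<close>
  have "C / M \<le> norm (N g *v x) powr \<beta>"
    using lower[of "(x, y)" "(0, y)"] g \<beta> x
    by (simp add: mdist_snowflake_product action_eq algebra_simps)
  then have "C \<le> M * a g powr \<beta>"
    using g x M by (simp add: norm_N divide_le_eq mult.commute)
  then have "M * C \<le> M\<^sup>2 * a g powr \<beta>"
    using M by (simp add: power2_eq_square mult.assoc)
  then show ?thesis
    using upper[of p q] by (meson mdist_nonneg mult_right_mono order_trans)
qed

text \<open>Two points at height \<open>0\<close> have images whose first coordinates differ by
  \<open>N g *v (k g y1 - k g y2)\<close>. The factor \<open>a g powr \<beta>\<close> cancels,
  leaving a bound independent of \<open>g\<close>; this makes the orbit bounded.\<close>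

lemma k_diff_bound:
  assumes g: "g \<in> carrier G"
  shows "norm (k g y1 - k g y2) powr \<beta> \<le> M\<^sup>2 * dist y1 y2"
proof -
  have "norm (N g *v (k g y1 - k g y2)) powr \<beta> \<le> M\<^sup>2 * a g powr \<beta> * dist y1 y2"
    using mdist_action_le[OF g, of "(0, y1)" "(0, y2)"] g \<beta>
    by (simp add: mdist_snowflake_product action_eq matrix_vector_mult_diff_distrib)
  then show ?thesis
    using g a_pos[OF g] by (simp add: norm_N powr_mult mult.assoc mult.left_commute)
qed

lemma dist_\<sigma>_le_aux:
  assumes "g \<in> carrier G"
  shows "dist (\<sigma> g y1) (\<sigma> g y2) \<le> M\<^sup>2 * a g powr \<beta> * dist y1 y2"
  using mdist_action_le[of g "(0, y1)" "(0, y2)"] assms \<beta>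
  by (simp add: mdist_snowflake_product action_eq)

text \<open>Passing to the powers of \<open>g\<close> removes the factor \<open>M\<^sup>2\<close>.\<close>

lemma dist_\<sigma>_le:
  assumes g: "g \<in> carrier G"
  shows "dist (\<sigma> g y1) (\<sigma> g y2) \<le> a g powr \<beta> * dist y1 y2"
proof (cases "y1 = y2")
  \<comment> \<open>Distinct points are needed to cancel \<open>dist y1 y2\<close> and so bound the
    ratio \<open>c\<close> itself.\<close>
  case False
  obtain c where c: "c > 0" "\<And>y y'. dist (\<sigma> g y) (\<sigma> g y') = c * dist y y'"
    using similarity_\<sigma>[OF g] by (auto simp: similarity_def)
  have pow: "dist (\<sigma> (g [^] n) y1) (\<sigma> (g [^] n) y2) = c ^ n * dist y1 y2" for n :: nat
  proof (induction n)
    case (Suc n)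
    have "\<sigma> (g [^] Suc n) y = \<sigma> g (\<sigma> (g [^] n) y)" for y
      using g by (metis nat_pow_Suc2 nat_pow_closed \<sigma>_mult)
    then show ?case by (simp add: Suc c(2))
  qed (simp add: \<sigma>_one)
  have bound: "(c / a g powr \<beta>) ^ n \<le> M\<^sup>2" for n
  proof -
    have "c ^ n * dist y1 y2 \<le> M\<^sup>2 * (a g ^ n) powr \<beta> * dist y1 y2"
      using dist_\<sigma>_le_aux[of "g [^] n" y1 y2] g by (simp add: pow a_pow)
    then have "c ^ n \<le> M\<^sup>2 * (a g ^ n) powr \<beta>"
      using False by simp
    moreover have "(a g ^ n) powr \<beta> = (a g powr \<beta>) ^ n"
      using a_pos[OF g] by (simp add: powr_powr mult.commute flip: powr_realpow)
    ultimately show ?thesis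
      using a_pos[OF g] by (simp add: power_divide divide_le_eq)
  qed
  \<comment> \<open>Powers of a number greater than 1 would exceed \<open>M\<^sup>2\<close>.\<close>
  have "c / a g powr \<beta> \<le> 1"
    using real_arch_pow[of "c / a g powr \<beta>" "M\<^sup>2"] bound by (meson not_le)
  then have "c \<le> a g powr \<beta>"
    using a_pos[OF g] by (simp add: divide_le_eq)
  then show ?thesis by (simp add: c(2) mult_right_mono)
qed simp

text \<open>The reverse inequality is \<open>dist_\<sigma>_le\<close> for \<open>inv g\<close>,
  since \<open>a g * a (inv g) = 1\<close>.\<close>

lemma dist_\<sigma>:
  assumes g: "g \<in> carrier G"
  shows "dist (\<sigma> g y1) (\<sigma> g y2) = a g powr \<beta> * dist y1 y2"
proof (rule antisym[OF dist_\<sigma>_le[OF g]])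
  have "dist (\<sigma> (inv g) (\<sigma> g y1)) (\<sigma> (inv g) (\<sigma> g y2))
      \<le> a (inv g) powr \<beta> * dist (\<sigma> g y1) (\<sigma> g y2)"
    using g by (intro dist_\<sigma>_le) simp
  then have "dist y1 y2 \<le> a (inv g) powr \<beta> * dist (\<sigma> g y1) (\<sigma> g y2)"
    using g by (simp add: \<sigma>_one flip: \<sigma>_mult)
  then have "a g powr \<beta> * dist y1 y2
      \<le> a g powr \<beta> * (a (inv g) powr \<beta> * dist (\<sigma> g y1) (\<sigma> g y2))"
    by (intro mult_left_mono) auto
  also have "\<dots> = (a g * a (inv g)) powr \<beta> * dist (\<sigma> g y1) (\<sigma> g y2)"
    using a_pos[OF g] a_pos[of "inv g"] g by (simp add: powr_mult)
  also have "\<dots> = dist (\<sigma> g y1) (\<sigma> g y2)"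
    using g by (simp add: a_one flip: a_mult)
  finally show "a g powr \<beta> * dist y1 y2 \<le> dist (\<sigma> g y1) (\<sigma> g y2)" .
qed

text \<open>The hypothesis says that \<open>h0\<close> is a fixed point of the affine action. The
  conjugate then acts separately on both factors, and by \<open>dist_\<sigma>\<close> both snowflake
  and base distances scale by \<open>a g powr \<beta>\<close>, hence so does their maximum.\<close>

lemma similarity_shear_conjugate:
  assumes g: "g \<in> carrier G"
    and h0: "\<And>y. N g *v (h0 y - (k g y - k g y0)) = h0 (\<sigma> g y) - h0 (\<sigma> g y0)"
  shows "similarity (snowflake_product \<beta>) (shear h0 \<circ> \<phi> g \<circ> inv_into UNIV (shear h0))"
proof -
  let ?F = "shear h0 \<circ> \<phi> g \<circ> inv_into UNIV (shear h0)"
  \<comment> \<open>Directly, the first coordinate is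
    \<open>N g *v (x - h0 y + k g y) + h0 (\<sigma> g y)\<close>; substituting
    \<open>h0 (\<sigma> g y)\<close> from the hypothesis cancels every term in
    \<open>y\<close>.\<close>
  have F: "?F (x, y) = (N g *v (x + k g y0) + h0 (\<sigma> g y0), \<sigma> g y)" for x y
    using h0[of y] g unfolding comp_def inv_shear
    by (simp add: shear_def action_eq algebra_simps)
  have "mdist (snowflake_product \<beta>) (?F p) (?F q)
      = a g powr \<beta> * mdist (snowflake_product \<beta>) p q" for p q
  proof -
    obtain x1 y1 x2 y2 where pq: "p = (x1, y1)" "q = (x2, y2)" by fastforce
    have "norm (fst (?F p) - fst (?F q)) = a g * norm (x1 - x2)"
      unfolding pq F norm_N[OF g, symmetric] by (simp add: algebra_simps)
    then show ?thesis
      using \<beta> a_pos[OF g]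
      by (simp add: pq F mdist_snowflake_product dist_\<sigma>[OF g] powr_mult max_mult_distrib_left
          del: o_apply)
  qed
  then show ?thesis
    using a_pos[OF g] \<beta> unfolding similarity_def
    by (intro conjI exI[of _ "a g powr \<beta>"]) (auto simp: mspace_snowflake_product simp del: o_apply)
qed

end

text \<open>The mean is left invariant, hence the average runs over \<open>k (inv g)\<close>: replacing \<open>g\<close> by
  \<open>inv d \<otimes> g\<close> turns \<open>inv g\<close> into \<open>inv g \<otimes> d\<close>, where the cocycle identity applies.\<close>

lemma (in quasisimilar_fibre_action) ex_invariant_shear:
  assumes T: "locally_compact_group G T" and amenable: "amenable G T"
    and cont: "continuous_action G T (snowflake_product \<beta>) \<phi>"
  shows "\<exists>h0 \<in> pointed_lipschitz_maps \<beta> y0. \<forall>g \<in> carrier G. \<forall>y.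
    N g *v (h0 y - (k g y - k g y0)) = h0 (\<sigma> g y) - h0 (\<sigma> g y0)"
proof -
  obtain \<mu> where "invariant_mean G T \<mu>"
    using locally_compact_group.amenableE[OF T amenable] .
  then interpret invariant_mean G T \<mu> .
  \<comment> \<open>Subtracting the value at \<open>y0\<close> is what gives bounded functions of
    \<open>g\<close>: the quasisimilarity controls only differences of \<open>k\<close>.\<close>
  define H where "H y g = k (inv g) y - k (inv g) y0" for y g
  define h0 where "h0 y = vector_mean (H y)" for y
  \<comment> \<open>The exponent \<open>1 / \<beta>\<close> undoes the snowflake, since the mean is
    linear in the Euclidean norm.\<close>
  have H_diff: "norm (H y1 g - H y2 g) \<le> (M\<^sup>2 * dist y1 y2) powr (1 / \<beta>)"
    if "g \<in> carrier G" for y1 y2 g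
  proof -
    have "(norm (H y1 g - H y2 g) powr \<beta>) powr (1 / \<beta>) \<le> (M\<^sup>2 * dist y1 y2) powr (1 / \<beta>)"
      using k_diff_bound[of "inv g" y1 y2] that \<beta> by (intro powr_mono2) (auto simp: H_def)
    then show ?thesis using \<beta> by (simp add: powr_powr)
  qed
  have H: "H y \<in> bounded_continuous_maps T" for y
  proof -
    have "continuous_map T euclidean (H y)"
      unfolding H_def
      by (intro continuous_map_diff continuous_map_k_inv[OF \<beta> T cont])
    \<comment> \<open>\<open>H y0\<close> vanishes on the group, so the difference bound at
      \<open>y0\<close> bounds \<open>H y\<close> itself.\<close>
    moreover have "bounded (H y ` topspace T)"
      using H_diff[of _ y y0] by (auto simp: bounded_iff topspace_eq H_def)
    ultimately show ?thesis by (simp add: bounded_continuous_maps_def)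
  qed
  have "norm (h0 y1 - h0 y2) powr \<beta> \<le> CARD('n) powr \<beta> * M\<^sup>2 * dist y1 y2" for y1 y2
  proof -
    have "norm (h0 y1 - h0 y2) \<le> CARD('n) * (M\<^sup>2 * dist y1 y2) powr (1 / \<beta>)"
      unfolding h0_def vector_mean_diff[OF H H, symmetric]
      by (intro norm_vector_mean_le bounded_continuous_maps_diff H H_diff)
    then have "norm (h0 y1 - h0 y2) powr \<beta>
        \<le> (CARD('n) * (M\<^sup>2 * dist y1 y2) powr (1 / \<beta>)) powr \<beta>"
      using \<beta> by (intro powr_mono2) auto
    also have "\<dots> = CARD('n) powr \<beta> * M\<^sup>2 * dist y1 y2"
      using \<beta> by (simp add: powr_mult powr_powr)
    finally show ?thesis .
  qed
  moreover have "h0 y0 = 0"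
    unfolding h0_def H_def by (simp add: vector_mean_const)
  ultimately have "h0 \<in> pointed_lipschitz_maps \<beta> y0"
    using \<beta> by (auto simp: pointed_lipschitz_maps_def Lipschitz_continuous_map_def
        mspace_snowflake_metric mdist_snowflake_metric)
  moreover have "N d *v (h0 y - (k d y - k d y0)) = h0 (\<sigma> d y) - h0 (\<sigma> d y0)"
    if d: "d \<in> carrier G" for d y
  proof -
    let ?K = "\<lambda>g. H y (inv d \<otimes> g)"
    have K: "?K \<in> bounded_continuous_maps T"
      using d by (intro bounded_continuous_maps_translate H) auto
    have const: "(\<lambda>_. v) \<in> bounded_continuous_maps T" for v :: "real^'n"
      by (auto simp: bounded_continuous_maps_def image_constant_conv)
    have Kc: "(\<lambda>g. ?K g - (k d y - k d y0)) \<in> bounded_continuous_maps T"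
      by (intro bounded_continuous_maps_diff K const)
    have "N d *v (h0 y - (k d y - k d y0))
        = N d *v (vector_mean ?K - vector_mean (\<lambda>_. k d y - k d y0))"
      using d by (simp add: h0_def vector_mean_const vector_mean_invariant[OF H])
    also have "\<dots> = vector_mean (\<lambda>g. N d *v (?K g - (k d y - k d y0)))"
      by (simp add: vector_mean_matrix_mult[OF Kc] vector_mean_diff[OF K const])
    \<comment> \<open>Pointwise this is \<open>k_mult\<close> for \<open>inv g\<close> and
      \<open>d\<close>, at \<open>y\<close> minus at \<open>y0\<close>.\<close>
    also have "\<dots> = vector_mean (\<lambda>g. H (\<sigma> d y) g - H (\<sigma> d y0) g)"
    proof (rule vector_mean_cong)
      show "(\<lambda>g. N d *v (?K g - (k d y - k d y0))) \<in> bounded_continuous_maps T"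
        by (rule bounded_continuous_maps_linear[OF Kc]) simp
      show "(\<lambda>g. H (\<sigma> d y) g - H (\<sigma> d y0) g) \<in> bounded_continuous_maps T"
        by (intro bounded_continuous_maps_diff H)
      fix g assume g: "g \<in> carrier G"
      have "?K g - (k d y - k d y0)
          = (k (inv g \<otimes> d) y - k d y) - (k (inv g \<otimes> d) y0 - k d y0)"
        using g d by (simp add: H_def inv_mult_group)
      then have "N d *v (?K g - (k d y - k d y0))
          = N d *v (k (inv g \<otimes> d) y - k d y) - N d *v (k (inv g \<otimes> d) y0 - k d y0)"
        by (simp only: matrix_vector_mult_diff_distrib)
      then show "N d *v (?K g - (k d y - k d y0)) = H (\<sigma> d y) g - H (\<sigma> d y0) g"
        using g d by (simp add: k_mult[OF inv_closed] H_def)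
    qed
    also have "\<dots> = h0 (\<sigma> d y) - h0 (\<sigma> d y0)"
      by (simp add: h0_def vector_mean_diff[OF H H])
    finally show ?thesis .
  qed
  ultimately show ?thesis by blast
qed

theorem theorem3p3:
  fixes \<beta> :: real
    and y0 :: "'y::metric_space"
    and \<Gamma> :: "('g, 'k) monoid_scheme"
    and T :: "'g topology"
    and \<phi> :: "'g \<Rightarrow> (real^'n) \<times> 'y \<Rightarrow> (real^'n) \<times> 'y"
  assumes "0 < \<beta>" and "\<beta> \<le> 1"
    and "locally_compact_group \<Gamma> T"
    and "continuous_action \<Gamma> T (snowflake_product \<beta>) \<phi>"
    and "\<forall>\<gamma>\<in>carrier \<Gamma>. bilipschitz (snowflake_product \<beta>) (\<phi> \<gamma>)"
    and "\<forall>\<gamma>\<in>carrier \<Gamma>. \<exists>(a::real) (A::real^'n^'n) (v::real^'n) h \<sigma>.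
           a > 0 \<and> orthogonal_matrix A \<and> h \<in> pointed_lipschitz_maps \<beta> y0 \<and>
           similarity euclidean_metric \<sigma> \<and>
           (\<forall>x y. \<phi> \<gamma> (x, y) = (a *\<^sub>R (A *v (x + v + h y)), \<sigma> y))"
    and "amenable \<Gamma> T"
    and "uniform_quasisimilarity_group \<Gamma> (snowflake_product \<beta>) \<phi>"
  shows "\<exists>h0 \<in> pointed_lipschitz_maps \<beta> y0.
           bilipschitz (snowflake_product \<beta>) (shear h0) \<and>
           (\<forall>\<gamma>\<in>carrier \<Gamma>.
             similarity (snowflake_product \<beta>) (shear h0 \<circ> \<phi> \<gamma> \<circ> inv_into UNIV (shear h0)))"
proof -
  \<comment> \<open>Of the orthogonal part only the scaling of norms is kept; the translation is
    absorbed into \<open>k\<close>, which therefore need not vanish at \<open>y0\<close>.\<close>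
  have "\<exists>(a::real) (N::real^'n^'n) k \<sigma>.
      a > 0 \<and> (\<forall>x. norm (N *v x) = a * norm x) \<and> similarity euclidean_metric \<sigma> \<and>
      (\<forall>x y. \<phi> \<gamma> (x, y) = (N *v (x + k y), \<sigma> y))" if \<gamma>: "\<gamma> \<in> carrier \<Gamma>" for \<gamma>
  proof -
    obtain a :: real and A :: "real^'n^'n" and v h \<sigma> where *: "a > 0" "orthogonal_matrix A"
      "similarity euclidean_metric \<sigma>" "\<And>x y. \<phi> \<gamma> (x, y) = (a *\<^sub>R (A *v (x + v + h y)), \<sigma> y)"
      using assms(6) \<gamma> by meson
    have "orthogonal_transformation ((*v) A)"
      using *(2) by (simp add: orthogonal_transformation_matrix)
    then have "norm ((a *\<^sub>R A) *v x) = a * norm x" for x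
      using *(1) by (simp add: orthogonal_transformation_norm flip: scaleR_matrix_vector_assoc)
    then show ?thesis
      using *(1,3,4)
      by (intro exI[of _ a] exI[of _ "a *\<^sub>R A"] exI[of _ "\<lambda>y. v + h y"] exI[of _ \<sigma>])
        (simp add: add.assoc flip: scaleR_matrix_vector_assoc)
  qed
  then obtain a :: "'g \<Rightarrow> real" and N :: "'g \<Rightarrow> real^'n^'n" and k \<sigma>
    where data: "\<And>\<gamma>. \<gamma> \<in> carrier \<Gamma> \<Longrightarrow> a \<gamma> > 0"
      "\<And>\<gamma> x. \<gamma> \<in> carrier \<Gamma> \<Longrightarrow> norm (N \<gamma> *v x) = a \<gamma> * norm x"
      "\<And>\<gamma>. \<gamma> \<in> carrier \<Gamma> \<Longrightarrow> similarity euclidean_metric (\<sigma> \<gamma>)"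
      "\<And>\<gamma> x y. \<gamma> \<in> carrier \<Gamma> \<Longrightarrow> \<phi> \<gamma> (x, y) = (N \<gamma> *v (x + k \<gamma> y), \<sigma> \<gamma> y)"
    by metis
  obtain M where M: "M \<ge> 1"
    "\<And>\<gamma>. \<gamma> \<in> carrier \<Gamma> \<Longrightarrow> \<exists>C>0. quasisimilarity (snowflake_product \<beta>) M C (\<phi> \<gamma>)"
    using assms(8) by (auto simp: uniform_quasisimilarity_group_def)
  have "group_action \<Gamma> UNIV \<phi>"
    using assms(1,2,4) by (simp add: continuous_action_def mspace_snowflake_product)
  then interpret quasisimilar_fibre_action \<Gamma> \<phi> a N k \<sigma> \<beta> M
    using data M assms(1,2)
    by (intro quasisimilar_fibre_action.intro fibre_similarity_action.intro
        fibre_similarity_action_axioms.intro quasisimilar_fibre_action_axioms.intro)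
  obtain h0 where h0: "h0 \<in> pointed_lipschitz_maps \<beta> y0"
    and eq: "\<forall>\<gamma>\<in>carrier \<Gamma>. \<forall>y.
      N \<gamma> *v (h0 y - (k \<gamma> y - k \<gamma> y0)) = h0 (\<sigma> \<gamma> y) - h0 (\<sigma> \<gamma> y0)"
    using ex_invariant_shear[OF assms(3,7,4), of y0] by (elim bexE)
  show ?thesis
  proof (intro bexI[OF _ h0] conjI ballI)
    show "bilipschitz (snowflake_product \<beta>) (shear h0)"
      using h0 by (rule bilipschitz_shear[OF assms(1,2)])
    fix \<gamma> assume "\<gamma> \<in> carrier \<Gamma>"
    then show "similarity (snowflake_product \<beta>)
        (shear h0 \<circ> \<phi> \<gamma> \<circ> inv_into UNIV (shear h0))"
      using eq by (intro similarity_shear_conjugate) auto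
  qed
qed

end
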